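(* Let $A_1A_2A_3$ be a translation triangle in $\mathbf{Nil}$ with translation surface $\mathcal{S}=\mathcal{S}^{\mathbf{Nil},t}_{A_1A_2A_3}$, and let $B_1B_2B_3$ be a translation triangle whose vertices lie in the same surface $\mathcal{S}$, with $A_i\neq B_i$ for $i=1,2,3$. Suppose the two triangles are centrally perspective with respect to a point $S\in\mathcal{S}$, i.e. the three translation curves $g_{A_1B_1}$, $g_{A_2B_2}$, $g_{A_3B_3}$ all pass through $S$. Suppose moreover that for each pair $(i,j)\in\{(1,2),(1,3),(2,3)\}$ the corresponding side curves $g_{A_iA_j}$ and $g_{B_iB_j}$ are distinct and have a common point $M_{ij}\in\mathbf{Nil}$ (that is, the points of intersection of the corresponding sides exist). Then $M_{12}$, $M_{13}$ and $M_{23}$ all lie on one translation curve.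
   Context: $\mathbf{Nil}$ is $\mathbb{R}^3$ with the Heisenberg group structure; the translation by $(x,y,z)$ maps the point $(a,b,c)$ to $(x+a,\;y+b,\;z+bx+c)$. A translation curve is a curve whose tangent vector at each point is the image, under the translation carrying the origin to that point, of a fixed nonzero vector $(u,v,w)$ at the origin. Explicitly, the translation curve starting at $(a,b,c)$ with data $(u,v,w)\neq(0,0,0)$ is $$t\mapsto\Bigl(a+ut,\;b+vt,\;c+avt+wt+\tfrac12uvt^2\Bigr),\qquad t\in\mathbb{R}.$$ Any two distinct points $P,Q$ lie on exactly one (complete) translation curve, denoted $g_{PQ}$. A translation triangle $A_1A_2A_3$ is given by three points (its vertices) not lying on one translation curve; its sides lie on the translation curves $g_{A_iA_j}$ (here sides are understood as the full curves). The translation surface $\mathcal{S}^{\mathbf{Nil},t}_{A_1A_2A_3}$ is the set of all points $P\in\mathbf{Nil}$ such that the tangent vectors at $P$ of the translation curves from $P$ to $A_1$, to $A_2$ and to $A_3$ are coplanar in the Euclidean sense (i.e. linearly dependent as vectors of $\mathbb{R}^3$); the vertices $A_1,A_2,A_3$ themselves are counted as belonging to the surface. *)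

theory Defs
  imports "HOL-Analysis.Analysis"
begin

type_synonym nil = "real \<times> real \<times> real"

fun nil_translate :: "nil \<Rightarrow> nil \<Rightarrow> nil" where
  "nil_translate (x, y, z) (a, b, c) = (x + a, y + b, z + b * x + c)"

fun nil_curve :: "nil \<Rightarrow> nil \<Rightarrow> real \<Rightarrow> nil" where
  "nil_curve (a, b, c) (u, v, w) t =
     (a + u * t, b + v * t, c + a * v * t + w * t + u * v * t\<^sup>2 / 2)"

definition translation_curve :: "nil set \<Rightarrow> bool" where
  "translation_curve C \<longleftrightarrow> (\<exists>P d. d \<noteq> 0 \<and> C = range (nil_curve P d))"

text \<open>The explicit formula is the one determined by the translations: the tangent vector of
  \<open>nil_curve P d\<close> at each of its points is the image of \<open>d\<close> under the differential at the
  origin of the translation carrying the origin to that point.\<close>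

lemma nil_translate_has_derivative:
  "(nil_translate (x, y, z) has_derivative (\<lambda>(u, v, w). (u, v, x * v + w))) (at p)"
proof -
  have eq: "nil_translate (x, y, z) =
      (\<lambda>q. (x + fst q, y + fst (snd q), z + fst (snd q) * x + snd (snd q)))"
    by (auto simp: fun_eq_iff)
  show ?thesis
    unfolding eq by (auto intro!: derivative_eq_intros simp: fun_eq_iff)
qed

lemma nil_curve_has_vector_derivative:
  "(nil_curve P d has_vector_derivative
      frechet_derivative (nil_translate (nil_curve P d t)) (at 0) d) (at t)"
proof -
  obtain a b c u v w where P: "P = (a, b, c)" and d: "d = (u, v, w)"
    by (metis prod_cases3)
  have "((\<lambda>t. (a + u * t, b + v * t, c + a * v * t + w * t + u * v * t\<^sup>2 / 2))
      has_vector_derivative (u, v, (a + u * t) * v + w)) (at t)"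
    unfolding has_vector_derivative_def
    by (auto intro!: derivative_eq_intros simp: fun_eq_iff algebra_simps)
  moreover have "frechet_derivative (nil_translate (nil_curve P d t)) (at 0) d
      = (u, v, (a + u * t) * v + w)"
    by (simp add: P d frechet_derivative_at[OF nil_translate_has_derivative, symmetric])
  moreover have "nil_curve P d =
      (\<lambda>t. (a + u * t, b + v * t, c + a * v * t + w * t + u * v * t\<^sup>2 / 2))"
    by (simp add: P d fun_eq_iff)
  ultimately show ?thesis by simp
qed

definition nil_g :: "nil \<Rightarrow> nil \<Rightarrow> nil set" where
  "nil_g P Q = (THE C. translation_curve C \<and> P \<in> C \<and> Q \<in> C)"

text \<open>\<open>nil_g P Q\<close> is meaningful for \<open>P \<noteq> Q\<close>.\<close>

lemma nil_curve_reparam: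
  "nil_curve (nil_curve (a, b, c) (u, v, w) s) (k * u, k * v, k * w) t
     = nil_curve (a, b, c) (u, v, w) (s + k * t)"
  by (simp add: algebra_simps power2_eq_square add_divide_distrib)

lemma nil_curve_unit_data:
  "nil_curve (a, b, c) (u, v, w) 1 = (x, y, z) \<longleftrightarrow>
     u = x - a \<and> v = y - b \<and> w = z - c - a * (y - b) - (x - a) * (y - b) / 2"
  by (auto simp: algebra_simps)

lemma translation_curve_rebase:
  assumes "translation_curve C" "P \<in> C" "Q \<in> C" "P \<noteq> Q"
  obtains d where "d \<noteq> 0" "C = range (nil_curve P d)" "nil_curve P d 1 = Q"
proof -
  from assms(1) obtain a b c u v w where C: "C = range (nil_curve (a, b, c) (u, v, w))"
    and nz: "(u, v, w) \<noteq> 0"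
    unfolding translation_curve_def by (metis prod_cases3)
  from assms(2,3) C obtain s r where s: "P = nil_curve (a, b, c) (u, v, w) s"
    and r: "Q = nil_curve (a, b, c) (u, v, w) r" by blast
  define k where "k = r - s"
  have k: "k \<noteq> 0" using assms(4) s r by (auto simp: k_def)
  let ?d = "(k * u, k * v, k * w)"
  have re: "nil_curve P ?d t = nil_curve (a, b, c) (u, v, w) (s + k * t)" for t
    unfolding s by (rule nil_curve_reparam)
  have "nil_curve (a, b, c) (u, v, w) t \<in> range (nil_curve P ?d)" for t
    by (rule range_eqI[of _ _ "(t - s) / k"]) (simp add: re k del: nil_curve.simps)
  hence "C = range (nil_curve P ?d)" unfolding C using re by auto
  moreover have "?d \<noteq> 0" using nz k by (auto simp: zero_prod_def)
  moreover have "nil_curve P ?d 1 = Q" unfolding re r by (simp add: k_def)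
  ultimately show ?thesis using that by blast
qed

lemma nil_g_unique:
  assumes "P \<noteq> Q"
  shows "\<exists>!C. translation_curve C \<and> P \<in> C \<and> Q \<in> C"
proof -
  obtain a b c x y z where P: "P = (a, b, c)" and Q: "Q = (x, y, z)" by (metis prod_cases3)
  define d where "d = (x - a, y - b, z - c - a * (y - b) - (x - a) * (y - b) / 2)"
  have d1: "nil_curve P d 1 = Q" unfolding P Q d_def by (subst nil_curve_unit_data) simp
  have d0: "nil_curve P d 0 = P" by (simp add: P d_def)
  have "d \<noteq> 0"
    using assms by (auto simp: P Q d_def zero_prod_def)
  hence ex: "translation_curve (range (nil_curve P d))" unfolding translation_curve_def by blast
  have un: "C = range (nil_curve P d)" if "translation_curve C" "P \<in> C" "Q \<in> C" for C
  proof -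
    from translation_curve_rebase[OF that assms] obtain e
      where e: "C = range (nil_curve P e)" "nil_curve P e 1 = Q" by blast
    obtain u v w where "e = (u, v, w)" by (metis prod_cases3)
    with e(2) have "e = d" unfolding P Q d_def by (simp only: nil_curve_unit_data)
    with e(1) show ?thesis by simp
  qed
  show ?thesis
  proof (rule ex1I[of _ "range (nil_curve P d)"])
    show "translation_curve (range (nil_curve P d)) \<and> P \<in> range (nil_curve P d)
        \<and> Q \<in> range (nil_curve P d)"
      using ex d0 d1 by (metis rangeI)
  qed (use un in blast)
qed

text \<open>Vertices of a triangle are automatically pairwise distinct, since any two points lie on
  a common translation curve.\<close>

definition translation_triangle :: "nil \<Rightarrow> nil \<Rightarrow> nil \<Rightarrow> bool" where
  "translation_triangle A1 A2 A3 \<longleftrightarrow>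
     \<not> (\<exists>C. translation_curve C \<and> A1 \<in> C \<and> A2 \<in> C \<and> A3 \<in> C)"

text \<open>\<open>T\<close> is a tangent vector at \<open>P\<close> of a translation curve that starts at \<open>P\<close> and reaches \<open>A\<close>.
  For \<open>A \<noteq> P\<close> it is determined up to a positive factor (the speed of the parametrization),
  which does not affect linear dependence.\<close>

definition nil_tangent :: "nil \<Rightarrow> nil \<Rightarrow> nil \<Rightarrow> bool" where
  "nil_tangent P A T \<longleftrightarrow> (\<exists>d t. d \<noteq> 0 \<and> t > 0 \<and> nil_curve P d t = A \<and>
     (nil_curve P d has_vector_derivative T) (at 0))"

text \<open>Linear dependence of the family; the library's \<open>dependent\<close> on \<open>{T1, T2, T3}\<close> would
  ignore repeated vectors.\<close>

definition linearly_dependent3 :: "nil \<Rightarrow> nil \<Rightarrow> nil \<Rightarrow> bool" where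
  "linearly_dependent3 T1 T2 T3 \<longleftrightarrow> (\<exists>k1 k2 k3 :: real.
     (k1 \<noteq> 0 \<or> k2 \<noteq> 0 \<or> k3 \<noteq> 0) \<and> k1 *\<^sub>R T1 + k2 *\<^sub>R T2 + k3 *\<^sub>R T3 = 0)"

definition translation_surface :: "nil \<Rightarrow> nil \<Rightarrow> nil \<Rightarrow> nil set" where
  "translation_surface A1 A2 A3 = {A1, A2, A3} \<union>
     {P. \<exists>T1 T2 T3. nil_tangent P A1 T1 \<and> nil_tangent P A2 T2 \<and> nil_tangent P A3 T3 \<and>
           linearly_dependent3 T1 T2 T3}"

end

theory Submission
  imports Defs
begin

text \<open>In the coordinates \<open>(x, y, z - x * y / 2)\<close> every translation curve is a straight line, so
  the statement becomes Desargues' theorem in the affine space \<open>\<real>\<^sup>3\<close>. Write the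
  centre of perspectivity as \<open>S = \<alpha>\<^sub>i A\<^sub>i + (1 - \<alpha>\<^sub>i) B\<^sub>i\<close>. Equating two of these expressions
  shows that \<open>\<alpha>\<^sub>i A\<^sub>i - \<alpha>\<^sub>j A\<^sub>j\<close>, scaled to total weight 1, lies on both sides, so
  \<open>(\<alpha>\<^sub>i - \<alpha>\<^sub>j) M\<^sub>i\<^sub>j = \<alpha>\<^sub>i A\<^sub>i - \<alpha>\<^sub>j A\<^sub>j\<close>; adding these up cyclically gives an affine dependence
  of the three intersection points. No degenerate positions of \<open>S\<close> have to be singled out.\<close>

text \<open>Any point of the line may serve as base point, so two lines through a common point can
  be compared by direction alone.\<close>

lemma affine_hull_2_point_direction:
  fixes a b p :: "'a::real_vector"
  assumes "p \<in> affine hull {a, b}"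
  shows "affine hull {a, b} = range (\<lambda>t. p + t *\<^sub>R (b - a))"
proof -
  from assms obtain u v where uv: "p = u *\<^sub>R a + v *\<^sub>R b" "u + v = 1"
    unfolding affine_hull_2 by blast
  have u: "u = 1 - v" using uv(2) by simp
  have "x *\<^sub>R a + y *\<^sub>R b = p + (y - v) *\<^sub>R (b - a)" if "x + y = 1" for x y
  proof -
    have "x = 1 - y" using that by simp
    show ?thesis unfolding \<open>x = 1 - y\<close> by (simp add: uv(1) u algebra_simps)
  qed
  moreover have "p + t *\<^sub>R (b - a) = (1 - (v + t)) *\<^sub>R a + (v + t) *\<^sub>R b" for t
    by (simp add: uv(1) u algebra_simps)
  ultimately show ?thesis
    unfolding affine_hull_2 by (fastforce simp: image_iff)
qed

lemma range_line_scale: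
  fixes p d :: "'a::real_vector"
  assumes "k \<noteq> 0"
  shows "range (\<lambda>t. p + t *\<^sub>R (k *\<^sub>R d)) = range (\<lambda>t. p + t *\<^sub>R d)"
proof -
  have "p + t *\<^sub>R d \<in> range (\<lambda>t. p + t *\<^sub>R (k *\<^sub>R d))" for t
    using assms by (intro range_eqI[of _ _ "t / k"]) simp
  then show ?thesis by auto
qed

lemma affine_hull_2_eq_if_parallel:
  fixes a b c d p :: "'a::real_vector"
  assumes "p \<in> affine hull {a, b}" "p \<in> affine hull {c, d}"
    and "k \<noteq> 0" "d - c = k *\<^sub>R (b - a)"
  shows "affine hull {a, b} = affine hull {c, d}"
  unfolding affine_hull_2_point_direction[OF assms(1)] affine_hull_2_point_direction[OF assms(2)]
    assms(4) range_line_scale[OF assms(3)] ..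

lemma affine_hull_2_eq_if_mem:
  fixes a b p q :: "'a::real_vector"
  assumes "p \<in> affine hull {a, b}" "q \<in> affine hull {a, b}" "p \<noteq> q"
  shows "affine hull {a, b} = affine hull {p, q}"
proof -
  from assms(2) obtain k where k: "q = p + k *\<^sub>R (b - a)"
    unfolding affine_hull_2_point_direction[OF assms(1)] by blast
  have "p \<in> affine hull {p, q}" by (simp add: hull_inc)
  then show ?thesis
    using assms(1,3) k by (intro affine_hull_2_eq_if_parallel[of p a b p q k]) auto
qed

lemma perspective_sides_meet:
  fixes a1 a2 b1 b2 m s :: "'a::real_vector"
  assumes s1: "s = \<alpha>1 *\<^sub>R a1 + (1 - \<alpha>1) *\<^sub>R b1"
    and s2: "s = \<alpha>2 *\<^sub>R a2 + (1 - \<alpha>2) *\<^sub>R b2"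
    and "a1 \<noteq> a2" "b1 \<noteq> b2"
    and ne: "affine hull {a1, a2} \<noteq> affine hull {b1, b2}"
    and ma: "m \<in> affine hull {a1, a2}" and mb: "m \<in> affine hull {b1, b2}"
  shows "\<alpha>1 \<noteq> \<alpha>2 \<and> (\<alpha>1 - \<alpha>2) *\<^sub>R m = \<alpha>1 *\<^sub>R a1 - \<alpha>2 *\<^sub>R a2"
proof -
  have eq: "\<alpha>1 *\<^sub>R a1 - \<alpha>2 *\<^sub>R a2 = (1 - \<alpha>2) *\<^sub>R b2 - (1 - \<alpha>1) *\<^sub>R b1"
    using s1 s2 by (metis add_diff_eq diff_add_eq diff_eq_eq add.commute)
  have neq: "\<alpha>1 \<noteq> \<alpha>2"
  proof
    assume "\<alpha>1 = \<alpha>2"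
    with eq have par: "\<alpha>1 *\<^sub>R (a1 - a2) = (1 - \<alpha>1) *\<^sub>R (b2 - b1)"
      by (simp add: scaleR_right_diff_distrib)
    \<comment> \<open>In \<open>par\<close>, weight 0 would force \<open>b1 = b2\<close> and weight
      1 would force \<open>a1 = a2\<close>. Otherwise the two sides are parallel, and sharing
      \<open>m\<close> they coincide.\<close>
    with assms(3,4) have nz: "\<alpha>1 \<noteq> 0" "\<alpha>1 \<noteq> 1" by auto
    have "b2 - b1 = (1 / (1 - \<alpha>1)) *\<^sub>R ((1 - \<alpha>1) *\<^sub>R (b2 - b1))"
      using nz by simp
    also have "\<dots> = (- \<alpha>1 / (1 - \<alpha>1)) *\<^sub>R (a2 - a1)"
      unfolding par[symmetric] by (simp add: algebra_simps)
    finally have "b2 - b1 = (- \<alpha>1 / (1 - \<alpha>1)) *\<^sub>R (a2 - a1)" .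
    then show False
      using affine_hull_2_eq_if_parallel[OF ma mb, of "- \<alpha>1 / (1 - \<alpha>1)"] nz ne by force
  qed
  \<comment> \<open>By \<open>eq\<close> this point is an affine combination both of the a's and of
    the b's, hence a common point of the two lines. Distinct lines share at most one point, so it
    must be \<open>m\<close>.\<close>
  define n where "n = (1 / (\<alpha>1 - \<alpha>2)) *\<^sub>R (\<alpha>1 *\<^sub>R a1 - \<alpha>2 *\<^sub>R a2)"
  have "n = (\<alpha>1 / (\<alpha>1 - \<alpha>2)) *\<^sub>R a1 + (- \<alpha>2 / (\<alpha>1 - \<alpha>2)) *\<^sub>R a2"
    by (simp add: n_def scaleR_right_diff_distrib)
  moreover have "\<alpha>1 / (\<alpha>1 - \<alpha>2) + - \<alpha>2 / (\<alpha>1 - \<alpha>2) = 1"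
    using neq by (simp flip: diff_divide_distrib)
  ultimately have na: "n \<in> affine hull {a1, a2}"
    unfolding affine_hull_2 by blast
  have "n = (- ((1 - \<alpha>1) / (\<alpha>1 - \<alpha>2))) *\<^sub>R b1 + ((1 - \<alpha>2) / (\<alpha>1 - \<alpha>2)) *\<^sub>R b2"
    unfolding n_def eq by (simp add: scaleR_right_diff_distrib)
  moreover have "- ((1 - \<alpha>1) / (\<alpha>1 - \<alpha>2)) + (1 - \<alpha>2) / (\<alpha>1 - \<alpha>2) = 1"
    using neq by (simp flip: diff_divide_distrib)
  ultimately have nb: "n \<in> affine hull {b1, b2}"
    unfolding affine_hull_2 by blast
  have "m = n"
    using affine_hull_2_eq_if_mem[OF ma na] affine_hull_2_eq_if_mem[OF mb nb] ne by blast
  then show ?thesis using neq by (simp add: n_def)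
qed

theorem desargues_affine:
  fixes a1 a2 a3 b1 b2 b3 s m12 m13 m23 :: "'a::real_vector"
  assumes "a1 \<noteq> a2" "a1 \<noteq> a3" "a2 \<noteq> a3" "b1 \<noteq> b2" "b1 \<noteq> b3" "b2 \<noteq> b3"
    and "s \<in> affine hull {a1, b1}" "s \<in> affine hull {a2, b2}" "s \<in> affine hull {a3, b3}"
    and "affine hull {a1, a2} \<noteq> affine hull {b1, b2}"
    and "affine hull {a1, a3} \<noteq> affine hull {b1, b3}"
    and "affine hull {a2, a3} \<noteq> affine hull {b2, b3}"
    and "m12 \<in> affine hull {a1, a2} \<inter> affine hull {b1, b2}"
    and "m13 \<in> affine hull {a1, a3} \<inter> affine hull {b1, b3}"
    and "m23 \<in> affine hull {a2, a3} \<inter> affine hull {b2, b3}"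
  shows "m23 \<in> affine hull {m12, m13}"
proof -
  have weight: "\<exists>\<alpha>. s = \<alpha> *\<^sub>R a + (1 - \<alpha>) *\<^sub>R b" if "s \<in> affine hull {a, b}" for a b
    using that unfolding affine_hull_2 by clarify (metis add_diff_cancel_left')
  obtain \<alpha>1 \<alpha>2 \<alpha>3 where s: "s = \<alpha>1 *\<^sub>R a1 + (1 - \<alpha>1) *\<^sub>R b1"
    "s = \<alpha>2 *\<^sub>R a2 + (1 - \<alpha>2) *\<^sub>R b2" "s = \<alpha>3 *\<^sub>R a3 + (1 - \<alpha>3) *\<^sub>R b3"
    using weight assms(7-9) by meson
  have m12: "(\<alpha>1 - \<alpha>2) *\<^sub>R m12 = \<alpha>1 *\<^sub>R a1 - \<alpha>2 *\<^sub>R a2"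
    using perspective_sides_meet[OF s(1,2)] assms by blast
  have m13: "(\<alpha>1 - \<alpha>3) *\<^sub>R m13 = \<alpha>1 *\<^sub>R a1 - \<alpha>3 *\<^sub>R a3"
    using perspective_sides_meet[OF s(1,3)] assms by blast
  have m23: "\<alpha>2 \<noteq> \<alpha>3" "(\<alpha>2 - \<alpha>3) *\<^sub>R m23 = \<alpha>2 *\<^sub>R a2 - \<alpha>3 *\<^sub>R a3"
    using perspective_sides_meet[OF s(2,3)] assms by blast+
  have "m23 = (1 / (\<alpha>2 - \<alpha>3)) *\<^sub>R ((\<alpha>2 - \<alpha>3) *\<^sub>R m23)"
    using m23(1) by simp
  \<comment> \<open>The \<open>a1\<close> terms cancel. Only the weight difference of
    \<open>m23\<close> is divided by, so \<open>m12 = m13\<close> needs no separate case.\<close>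
  also have "(\<alpha>2 - \<alpha>3) *\<^sub>R m23 = (\<alpha>1 - \<alpha>3) *\<^sub>R m13 - (\<alpha>1 - \<alpha>2) *\<^sub>R m12"
    unfolding m12 m13 m23(2) by simp
  finally have "m23 = (- ((\<alpha>1 - \<alpha>2) / (\<alpha>2 - \<alpha>3))) *\<^sub>R m12 + ((\<alpha>1 - \<alpha>3) / (\<alpha>2 - \<alpha>3)) *\<^sub>R m13"
    by (simp add: scaleR_right_diff_distrib)
  moreover have "- ((\<alpha>1 - \<alpha>2) / (\<alpha>2 - \<alpha>3)) + (\<alpha>1 - \<alpha>3) / (\<alpha>2 - \<alpha>3) = 1"
    using m23(1) by (simp flip: diff_divide_distrib)
  ultimately show ?thesis
    unfolding affine_hull_2 by blast
qed

text \<open>This is the logarithm of the Heisenberg group: the inverse of the exponential map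
  \<open>(u, v, w)\<close> to \<open>(u, v, w + u * v / 2)\<close>.\<close>

fun nil_straighten :: "nil \<Rightarrow> nil" where
  "nil_straighten (x, y, z) = (x, y, z - x * y / 2)"

lemma nil_straighten_eq_iff [simp]: "nil_straighten P = nil_straighten Q \<longleftrightarrow> P = Q"
  by (cases P; cases Q) auto

text \<open>The quadratic term of the third coordinate cancels against that of
  \<open>x * y / 2\<close>. What remains is affine in \<open>t\<close>, so its values at 0 and 1
  determine it.\<close>

lemma nil_straighten_curve:
  "nil_straighten (nil_curve P d t) =
     nil_straighten P + t *\<^sub>R (nil_straighten (nil_curve P d 1) - nil_straighten P)"
  by (cases P; cases d) (simp add: algebra_simps power2_eq_square add_divide_distrib diff_divide_distrib)

lemma nil_g_props:
  assumes "P \<noteq> Q"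
  shows "translation_curve (nil_g P Q)" "P \<in> nil_g P Q" "Q \<in> nil_g P Q"
  using theI'[OF nil_g_unique[OF assms]] by (auto simp: nil_g_def)

lemma nil_g_eq_vimage_line:
  assumes "P \<noteq> Q"
  shows "nil_g P Q = nil_straighten -` (affine hull {nil_straighten P, nil_straighten Q})"
proof -
  obtain d where d: "nil_g P Q = range (nil_curve P d)" "nil_curve P d 1 = Q"
    using translation_curve_rebase[OF nil_g_props[OF assms] assms] by blast
  have "R \<in> nil_g P Q \<longleftrightarrow>
      (\<exists>t. nil_straighten R = nil_straighten P + t *\<^sub>R (nil_straighten Q - nil_straighten P))" for R
    \<comment> \<open>Writing \<open>Q\<close> as the curve point at parameter 1 turns the
      right-hand side into a straightened curve point; injectivity of \<open>nil_straighten\<close>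
      then removes the map.\<close>
    unfolding d(1) unfolding d(2)[symmetric] nil_straighten_curve[symmetric]
    by (simp add: image_iff)
  moreover have "affine hull {nil_straighten P, nil_straighten Q} =
      range (\<lambda>t. nil_straighten P + t *\<^sub>R (nil_straighten Q - nil_straighten P))"
    by (rule affine_hull_2_point_direction) (simp add: hull_inc)
  ultimately show ?thesis by blast
qed

lemma translation_curve_through:
  obtains C where "translation_curve C" "P \<in> C" "Q \<in> C"
proof (cases "P = Q")
  case True
  have "P = nil_curve P (1, 0, 0) 0" by (cases P) simp
  then have "P \<in> range (nil_curve P (1, 0, 0))" by (rule range_eqI)
  moreover have "translation_curve (range (nil_curve P (1, 0, 0)))"
    unfolding translation_curve_def by (metis Pair_inject zero_neq_one zero_prod_def)
  ultimately show ?thesis using True that by blast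
next
  case False
  then show ?thesis using that nil_g_props by blast
qed

lemma translation_triangle_distinct:
  assumes "translation_triangle A1 A2 A3"
  shows "A1 \<noteq> A2" "A1 \<noteq> A3" "A2 \<noteq> A3"
  using assms translation_curve_through unfolding translation_triangle_def by metis+

theorem theorem2p8:
  fixes A1 A2 A3 B1 B2 B3 S M12 M13 M23 :: nil
  assumes "translation_triangle A1 A2 A3"
    and "translation_triangle B1 B2 B3"
    and "B1 \<in> translation_surface A1 A2 A3"
    and "B2 \<in> translation_surface A1 A2 A3"
    and "B3 \<in> translation_surface A1 A2 A3"
    and "A1 \<noteq> B1" and "A2 \<noteq> B2" and "A3 \<noteq> B3"
    and "S \<in> translation_surface A1 A2 A3"
    and "S \<in> nil_g A1 B1" and "S \<in> nil_g A2 B2" and "S \<in> nil_g A3 B3"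
    and "nil_g A1 A2 \<noteq> nil_g B1 B2"
    and "nil_g A1 A3 \<noteq> nil_g B1 B3"
    and "nil_g A2 A3 \<noteq> nil_g B2 B3"
    and "M12 \<in> nil_g A1 A2 \<inter> nil_g B1 B2"
    and "M13 \<in> nil_g A1 A3 \<inter> nil_g B1 B3"
    and "M23 \<in> nil_g A2 A3 \<inter> nil_g B2 B3"
  shows "\<exists>C. translation_curve C \<and> M12 \<in> C \<and> M13 \<in> C \<and> M23 \<in> C"
proof -
  note distinct = translation_triangle_distinct[OF assms(1)] translation_triangle_distinct[OF assms(2)]
  note line = nil_g_eq_vimage_line
  have "nil_straighten M23 \<in> affine hull {nil_straighten M12, nil_straighten M13}"
  proof (rule desargues_affine)
    show "nil_straighten S \<in> affine hull {nil_straighten A1, nil_straighten B1}"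
      "nil_straighten S \<in> affine hull {nil_straighten A2, nil_straighten B2}"
      "nil_straighten S \<in> affine hull {nil_straighten A3, nil_straighten B3}"
      using assms(6-8,10-12) by (simp_all add: line)
  \<comment> \<open>Distinct curves come from distinct lines, since equal lines have equal
    preimages.\<close>
  qed (use assms(13-18) distinct in \<open>auto simp: line\<close>)
  then have "M12 \<noteq> M13 \<Longrightarrow> M23 \<in> nil_g M12 M13"
    by (simp add: line)
  \<comment> \<open>If \<open>M12 = M13\<close>, any curve through \<open>M12\<close> and
    \<open>M23\<close> serves.\<close>
  then show ?thesis
    using nil_g_props[of M12 M13] translation_curve_through[of M12 M23] by metis
qed

end
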